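(* Let $D \subseteq {}^3({}^\omega 2)$ be defined by $$D = \{(x,y,z) \in {}^3({}^\omega 2) : (\exists n)(x(n) \neq y(n) \wedge x(n) \neq z(n) \wedge y(n+1) \neq z(n+1))\}.$$ Then $D$ is dense open in ${}^3({}^\omega 2)$. Moreover, if $p$ is an $E_0$-tree with witnessing strings $s, v_n^i$ ($n\in\omega$, $i\in 2$) and $\Phi:{}^\omega 2\to[p]$ is its canonical map, then $$(\Phi(\widetilde{010}), \Phi(\widetilde{110}), \Phi(\tilde 1)) \notin D.$$ Consequently $E_0$ does not have the $3$-Mycielski property.
   Context: For $\sigma\in{}^{<\omega}2$ of length $k>0$, $\tilde\sigma\in{}^\omega 2$ is defined by $\tilde\sigma(n)=\sigma(j)$ where $0\le j<k$ and $j\equiv n \pmod k$ (so $\tilde 1$ is the constant $1$ sequence, $\widetilde{010}$ is $010010010\dots$). $E_0$ is the equivalence relation on ${}^\omega 2$ given by $x\,E_0\,y$ iff $(\exists n)(\forall k>n)(x(k)=y(k))$. An $E_0$-tree is a tree $p\subseteq{}^{<\omega}2$ for which there are strings $s, v_n^i\in{}^{<\omega}2$ ($n\in\omega$, $i\in 2$) with $\langle i\rangle\subseteq v_n^i$ (i.e. $v_n^i$ begins with $i$) and $|v_n^0|=|v_n^1|$, such that, setting $\varphi(\emptyset)=s$ and $\varphi(\sigma)=s^\frown v_0^{\sigma(0)}{}^\frown\cdots{}^\frown v_{|\sigma|-1}^{\sigma(|\sigma|-1)}$ for nonempty $\sigma\in{}^{<\omega}2$, $p$ is the $\subseteq$-downward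 closure of $\{\varphi(\sigma):\sigma\in{}^{<\omega}2\}$. Its canonical map is $\Phi(x)=\bigcup_{n}\varphi(x\upharpoonright n)$. For an equivalence relation $E$ on a set $X$ and $n\in\omega$, $[X]^n_E=\{(x_0,\dots,x_{n-1})\in{}^nX : (\forall i\neq j)\,\neg(x_i\,E\,x_j)\}$. For equivalence relations $E,F$ on Polish spaces $X,Y$, $E\le_{\Delta^1_1}F$ means there is a $\Delta^1_1$ (Borel) function $\Phi:X\to Y$ with $a\,E\,b\iff\Phi(a)\,F\,\Phi(b)$; $E\equiv_{\Delta^1_1}F$ means both directions hold. An equivalence relation $E$ on a Polish space $X$ has the $n$-Mycielski property iff for every comeager $C\subseteq{}^nX$ there is a $\Delta^1_1$ set $A\subseteq X$ with $E\equiv_{\Delta^1_1}E\upharpoonright A$ and $[A]^n_E\subseteq C$. *)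

theory Defs
  imports "HOL-Analysis.Analysis" "HOL-Library.Sublist"
begin

text \<open>Cantor space is \<^typ>\<open>nat \<Rightarrow> bool\<close> with the product topology (False and True standing for
  0 and 1), and finite binary strings are \<^typ>\<open>bool list\<close>. The library makes \<^typ>\<open>bool\<close> a discrete
  topological space but not a metric one; the discrete metric below makes it, and hence
  \<^typ>\<open>nat \<Rightarrow> bool\<close>, an instance of \<^class>\<open>polish_space\<close> without changing the topology.\<close>

instantiation bool :: metric_space
begin

definition dist_bool :: "bool \<Rightarrow> bool \<Rightarrow> real" where
  "dist_bool x y = (if x = y then 0 else 1)"

definition uniformity_bool :: "(bool \<times> bool) filter" where
  "uniformity_bool = (INF e\<in>{0<..}. principal {(x, y). dist x y < e})"

instance
proof
  show "(uniformity :: (bool \<times> bool) filter) = (INF e\<in>{0<..}. principal {(x, y). dist x y < e})"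
    by (rule uniformity_bool_def)
  have "(INF e\<in>{0<..}. principal {(x::bool, y). dist x y < e}) = principal Id"
  proof (rule antisym)
    have "(INF e\<in>{0<..}. principal {(x::bool, y). dist x y < e}) \<le> principal {(x, y). dist x y < 1}"
      by (rule INF_lower) simp
    also have "{(x::bool, y). dist x y < 1} = Id"
      by (auto simp: dist_bool_def split: if_splits)
    finally show "(INF e\<in>{0<..}. principal {(x::bool, y). dist x y < e}) \<le> principal Id" .
    show "principal Id \<le> (INF e\<in>{0<..}. principal {(x::bool, y). dist x y < e})"
      by (rule INF_greatest) (auto simp: dist_bool_def)
  qed
  then have eq: "(uniformity :: (bool \<times> bool) filter) = principal Id"
    by (simp only: uniformity_bool_def)
  show "open U \<longleftrightarrow> (\<forall>x\<in>U. eventually (\<lambda>(x', y). x' = x \<longrightarrow> y \<in> U) uniformity)" for U :: "bool set"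
    unfolding eq eventually_principal by (auto simp: open_discrete)
qed (auto simp: dist_bool_def)

end

instance bool :: polish_space
proof
  show "\<exists>B::bool set set. countable B \<and> open = generate_topology B"
  proof (intro exI conjI)
    show "countable (UNIV :: bool set set)" by (simp add: countable_finite)
    show "open = generate_topology (UNIV :: bool set set)"
      by (rule ext) (simp add: open_discrete generate_topology.Basis)
  qed
  fix X :: "nat \<Rightarrow> bool"
  assume "Cauchy X"
  then obtain M where "\<forall>m\<ge>M. \<forall>n\<ge>M. dist (X m) (X n) < 1"
    by (metis Cauchy_def zero_less_one)
  then have "\<forall>m\<ge>M. X m = X M" 
    by (force simp: dist_bool_def split: if_splits)
  then have "eventually (\<lambda>m. X m = X M) sequentially"
    unfolding eventually_sequentially by blast
  then have "X \<longlonglongrightarrow> X M"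
    by (rule tendsto_eventually)
  then show "convergent X" by (rule convergentI)
qed

definition nowhere_dense_in :: "'a topology \<Rightarrow> 'a set \<Rightarrow> bool" where
  "nowhere_dense_in X S \<longleftrightarrow> S \<subseteq> topspace X \<and> X interior_of (X closure_of S) = {}"

definition meager_in :: "'a topology \<Rightarrow> 'a set \<Rightarrow> bool" where
  "meager_in X S \<longleftrightarrow> (\<exists>\<N>. countable \<N> \<and> (\<forall>N\<in>\<N>. nowhere_dense_in X N) \<and> S = \<Union>\<N>)"

definition comeager_in :: "'a topology \<Rightarrow> 'a set \<Rightarrow> bool" where
  "comeager_in X C \<longleftrightarrow> C \<subseteq> topspace X \<and> meager_in X (topspace X - C)"

text \<open>The \<open>n\<close>-th power of a space consists of the extensional functions on \<open>{..<n}\<close>.\<close>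

definition power_space :: "nat \<Rightarrow> (nat \<Rightarrow> 'a::topological_space) topology" where
  "power_space n = product_topology (\<lambda>_. euclidean) {..<n}"

definition inequivalent_tuples :: "nat \<Rightarrow> 'a rel \<Rightarrow> 'a set \<Rightarrow> (nat \<Rightarrow> 'a) set" where
  "inequivalent_tuples n E A =
     {x \<in> {..<n} \<rightarrow>\<^sub>E A. \<forall>i<n. \<forall>j<n. i \<noteq> j \<longrightarrow> (x i, x j) \<notin> E}"

text \<open>The underlying sets \<open>X\<close> and \<open>Y\<close> are explicit so that the notion also covers restrictions
  \<open>E \<restriction> A\<close> to Borel sets \<open>A\<close>. The function is only relevant on \<open>X\<close>, and has to map \<open>X\<close> into \<open>Y\<close>.\<close>

definition borel_reducible ::
    "'a::polish_space set \<Rightarrow> 'a rel \<Rightarrow> 'b::polish_space set \<Rightarrow> 'b rel \<Rightarrow> bool" where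
  "borel_reducible X E Y F \<longleftrightarrow>
     (\<exists>f \<in> restrict_space borel X \<rightarrow>\<^sub>M restrict_space borel Y.
        \<forall>a\<in>X. \<forall>b\<in>X. (a, b) \<in> E \<longleftrightarrow> (f a, f b) \<in> F)"

definition borel_bireducible ::
    "'a::polish_space set \<Rightarrow> 'a rel \<Rightarrow> 'b::polish_space set \<Rightarrow> 'b rel \<Rightarrow> bool" where
  "borel_bireducible X E Y F \<longleftrightarrow> borel_reducible X E Y F \<and> borel_reducible Y F X E"

definition mycielski_property :: "nat \<Rightarrow> 'a::polish_space rel \<Rightarrow> bool" where
  "mycielski_property n E \<longleftrightarrow>
     (\<forall>C. comeager_in (power_space n) C \<longrightarrow>
        (\<exists>A \<in> sets borel. borel_bireducible UNIV E A (Restr E A) \<and>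
                          inequivalent_tuples n E A \<subseteq> C))"

definition E0 :: "(nat \<Rightarrow> bool) rel" where
  "E0 = {(x, y). \<exists>n. \<forall>k>n. x k = y k}"

lemma equiv_E0: "equiv UNIV E0"
proof (rule equivI)
  show "E0 \<subseteq> UNIV \<times> UNIV" by simp
  show "refl E0" by (auto simp: E0_def refl_on_def)
  show "sym E0" by (auto simp: E0_def sym_def)
  show "trans E0"
  proof (rule transI)
    fix x y z assume "(x, y) \<in> E0" "(y, z) \<in> E0"
    then obtain m n where "\<forall>k>m. x k = y k" "\<forall>k>n. y k = z k" by (auto simp: E0_def)
    then have "\<forall>k>max m n. x k = z k" by auto
    then show "(x, z) \<in> E0" unfolding E0_def by blast
  qed
qed

definition E0_string :: "bool list \<Rightarrow> (nat \<Rightarrow> bool \<Rightarrow> bool list) \<Rightarrow> bool list \<Rightarrow> bool list" where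
  "E0_string s v \<sigma> = s @ concat (map (\<lambda>k. v k (\<sigma> ! k)) [0..<length \<sigma>])"

definition E0_tree_with ::
    "bool list set \<Rightarrow> bool list \<Rightarrow> (nat \<Rightarrow> bool \<Rightarrow> bool list) \<Rightarrow> bool" where
  "E0_tree_with p s v \<longleftrightarrow>
     (\<forall>n i. prefix [i] (v n i)) \<and>
     (\<forall>n. length (v n False) = length (v n True)) \<and>
     p = {\<tau>. \<exists>\<sigma>. prefix \<tau> (E0_string s v \<sigma>)}"

definition tree_body :: "bool list set \<Rightarrow> (nat \<Rightarrow> bool) set" where
  "tree_body p = {x. \<forall>n. map x [0..<n] \<in> p}"

text \<open>The union of the strings \<open>\<phi>(x \<restriction> n)\<close>, viewed as partial functions, evaluated at \<open>k\<close>.\<close>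

definition canonical_map ::
    "bool list \<Rightarrow> (nat \<Rightarrow> bool \<Rightarrow> bool list) \<Rightarrow> (nat \<Rightarrow> bool) \<Rightarrow> (nat \<Rightarrow> bool)" where
  "canonical_map s v x k =
     (THE b. \<exists>n. k < length (E0_string s v (map x [0..<n])) \<and>
                 b = E0_string s v (map x [0..<n]) ! k)"

lemma E0_string_Suc:
  "E0_string s v (map x [0..<Suc n]) = E0_string s v (map x [0..<n]) @ v n (x n)"
proof -
  have eq: "E0_string s v (map x [0..<m]) = s @ concat (map (\<lambda>k. v k (x k)) [0..<m])" for m
    unfolding E0_string_def by (auto intro!: arg_cong[of _ _ concat])
  show ?thesis unfolding eq by simp
qed

lemma prefix_E0_string:
  "m \<le> n \<Longrightarrow> prefix (E0_string s v (map x [0..<m])) (E0_string s v (map x [0..<n]))"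
  by (induction n rule: dec_induct) (simp_all only: E0_string_Suc prefix_order.refl prefix_prefix)

lemma canonical_map_eq:
  assumes "k < length (E0_string s v (map x [0..<n]))"
  shows "canonical_map s v x k = E0_string s v (map x [0..<n]) ! k"
  unfolding canonical_map_def
proof (rule the_equality)
  fix b assume "\<exists>m. k < length (E0_string s v (map x [0..<m])) \<and> b = E0_string s v (map x [0..<m]) ! k"
  then obtain m where m: "k < length (E0_string s v (map x [0..<m]))"
    "b = E0_string s v (map x [0..<m]) ! k" by blast
  show "b = E0_string s v (map x [0..<n]) ! k"
    using m assms prefix_E0_string[of m n s v x] prefix_E0_string[of n m s v x]
    by (metis linear nth_append prefix_def)
qed (use assms in auto)

lemma length_E0_string:
  assumes "E0_tree_with p s v"
  shows "n \<le> length (E0_string s v (map x [0..<n]))"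
proof (induction n)
  case (Suc n)
  have "prefix [x n] (v n (x n))" using assms by (auto simp: E0_tree_with_def)
  then have "1 \<le> length (v n (x n))" by (auto dest: prefix_length_le)
  with Suc show ?case by (simp only: E0_string_Suc length_append)
qed simp

lemma canonical_map_in_body:
  assumes "E0_tree_with p s v"
  shows "canonical_map s v x \<in> tree_body p"
proof -
  have "map (canonical_map s v x) [0..<n] = take n (E0_string s v (map x [0..<n]))" for n
    using length_E0_string[OF assms, of n x]
    by (intro nth_equalityI) (simp_all add: canonical_map_eq[of _ s v x n])
  then have "prefix (map (canonical_map s v x) [0..<n]) (E0_string s v (map x [0..<n]))" for n
    by (simp add: take_is_prefix)
  then show ?thesis using assms by (auto simp: E0_tree_with_def tree_body_def)
qed

text \<open>Only meaningful for nonempty \<open>\<sigma>\<close>.\<close>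

definition periodic :: "bool list \<Rightarrow> nat \<Rightarrow> bool" where
  "periodic \<sigma> n = \<sigma> ! (n mod length \<sigma>)"

definition triple :: "'a \<Rightarrow> 'a \<Rightarrow> 'a \<Rightarrow> nat \<Rightarrow> 'a" where
  "triple x y z = (\<lambda>i\<in>{..<3}. [x, y, z] ! i)"

definition D :: "(nat \<Rightarrow> nat \<Rightarrow> bool) set" where
  "D = {triple x y z | x y z. \<exists>n. x n \<noteq> y n \<and> x n \<noteq> z n \<and> y (n + 1) \<noteq> z (n + 1)}"

end

theory Submission
  imports Defs "HOL-Library.Omega_Words_Fun"
begin

text \<open>On the \<open>n\<close>-th block of an \<open>E\<^sub>0\<close>-tree the three branches follow \<open>(0,1,1)\<close>, \<open>(1,1,1)\<close> or
  \<open>(0,0,1)\<close> in turn, so the first branch can only be the odd one out inside a block of the first kind,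
  where the other two agree up to and including the first letter of the next block.

  If \<open>A\<close> had the properties required by the Mycielski property for \<open>D\<close>, there would be a Borel
  reduction \<open>f\<close> of \<open>E\<^sub>0\<close> to itself with values in \<open>A\<close>. As \<open>f\<close> is not generically constant, there
  are a cylinder and two strings \<open>e\<^sub>0, e\<^sub>1\<close> such that generically \<open>f (e\<^sub>i \<frown> a) = w\<^sub>i \<frown> b\<close> with \<open>b\<close> depending
  only on \<open>a\<close> and distinct \<open>w\<^sub>0, w\<^sub>1\<close> of the same length; the tail map \<open>a \<mapsto> b\<close> is again a reduction.
  Iterating this with a fusion argument gives a tree of the above kind whose branches are values of
  \<open>f\<close>, and hence three inequivalent points of \<open>A\<close> whose triple is not in \<open>D\<close>.\<close>

section \<open>Comeagerness in Cantor space through dense sets of strings\<close>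

text \<open>Comeagerness in Cantor space, with a dense open set coded by a set of strings that every string
  can be extended into.\<close>

definition generic :: "((nat \<Rightarrow> bool) \<Rightarrow> bool) \<Rightarrow> bool" where
  "generic P \<longleftrightarrow> (\<exists>S :: nat \<Rightarrow> bool list set. (\<forall>n t. \<exists>r. t @ r \<in> S n) \<and>
     (\<forall>a. (\<forall>n. \<exists>u\<in>S n. \<exists>b. a = u \<frown> b) \<longrightarrow> P a))"

lemma genericI:
  fixes S :: "nat \<Rightarrow> bool list set"
  assumes "\<And>n t. \<exists>r. t @ r \<in> S n" "\<And>a. (\<And>n. \<exists>u\<in>S n. \<exists>b. a = u \<frown> b) \<Longrightarrow> P a"
  shows "generic P"
  unfolding generic_def by (intro exI[of _ S] conjI allI impI assms) simp

lemma genericE: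
  assumes "generic P"
  obtains S :: "nat \<Rightarrow> bool list set" where "\<And>n t. \<exists>r. t @ r \<in> S n"
    "\<And>a. (\<And>n. \<exists>u\<in>S n. \<exists>b. a = u \<frown> b) \<Longrightarrow> P a"
  using assms unfolding generic_def by metis

lemma generic_mono: "generic P \<Longrightarrow> (\<And>a. P a \<Longrightarrow> Q a) \<Longrightarrow> generic Q"
  unfolding generic_def by metis

lemma generic_trivial: "(\<And>a. P a) \<Longrightarrow> generic P"
  by (rule genericI[of "\<lambda>_. UNIV"]) auto

lemma generic_dense:
  assumes "\<And>t. \<exists>r. t @ r \<in> S"
  shows "generic (\<lambda>a. \<exists>u\<in>S. \<exists>b. a = u \<frown> b)"
  by (rule genericI[of "\<lambda>_. S"]) (use assms in auto)

text \<open>The countably many sequences of dense sets are merged into one by the pairing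
  \<open>prod_decode\<close>.\<close>

lemma generic_all:
  fixes P :: "'i::countable \<Rightarrow> (nat \<Rightarrow> bool) \<Rightarrow> bool"
  assumes "\<And>i. generic (P i)"
  shows "generic (\<lambda>a. \<forall>i. P i a)"
proof -
  have "\<forall>i. \<exists>S :: nat \<Rightarrow> bool list set. (\<forall>n t. \<exists>r. t @ r \<in> S n) \<and>
     (\<forall>a. (\<forall>n. \<exists>u\<in>S n. \<exists>b. a = u \<frown> b) \<longrightarrow> P i a)"
    using assms unfolding generic_def by blast
  then obtain S :: "'i \<Rightarrow> nat \<Rightarrow> bool list set" where S: "\<And>i n t. \<exists>r. t @ r \<in> S i n"
    "\<And>i a. (\<And>n. \<exists>u\<in>S i n. \<exists>b. a = u \<frown> b) \<Longrightarrow> P i a"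
    by metis
  show ?thesis
  proof (rule genericI[of "\<lambda>m. S (from_nat (fst (prod_decode m))) (snd (prod_decode m))"])
    fix a assume a: "\<And>m. \<exists>u\<in>S (from_nat (fst (prod_decode m))) (snd (prod_decode m)). \<exists>b. a = u \<frown> b"
    have "\<exists>u\<in>S i n. \<exists>b. a = u \<frown> b" for i n
      using a[of "prod_encode (to_nat i, n)"] by simp
    then show "\<forall>i. P i a" using S(2) by blast
  qed (rule S(1))
qed

lemma generic_conj:
  assumes "generic P" "generic Q"
  shows "generic (\<lambda>a. P a \<and> Q a)"
proof -
  have "generic (\<lambda>a. if b then P a else Q a)" for b
    using assms by (cases b) simp_all
  then have "generic (\<lambda>a. \<forall>b. if b then P a else Q a)"
    by (rule generic_all)
  then show ?thesis by (rule generic_mono) (metis (full_types))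
qed

lemma generic_conc:
  assumes "generic P"
  shows "generic (\<lambda>a. P (t \<frown> a))"
proof -
  from assms obtain S :: "nat \<Rightarrow> bool list set" where S: "\<And>n t. \<exists>r. t @ r \<in> S n"
    "\<And>a. (\<And>n. \<exists>u\<in>S n. \<exists>b. a = u \<frown> b) \<Longrightarrow> P a"
    by (elim genericE) blast
  show ?thesis
  proof (rule genericI[of "\<lambda>n. {u. t @ u \<in> S n}"])
    show "\<exists>r. t' @ r \<in> {u. t @ u \<in> S n}" for n t'
      using S(1)[of "t @ t'" n] by simp
    fix a assume a: "\<And>n. \<exists>u\<in>{u. t @ u \<in> S n}. \<exists>b. a = u \<frown> b"
    show "P (t \<frown> a)"
      by (rule S(2)) (use a in fastforce)
  qed
qed

lemma conc_eq_cases: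
  assumes "t \<frown> a = u \<frown> c"
  obtains v where "t = u @ v" | v where "u = t @ v"
proof (cases "length u \<le> length t")
  case True
  have "u = take (length u) t"
    using arg_cong[OF assms, of "Omega_Words_Fun.prefix (length u)"] True by simp
  then show ?thesis using that(1) by (metis append_take_drop_id)
next
  case False
  have "t = take (length t) u"
    using arg_cong[OF assms, of "Omega_Words_Fun.prefix (length t)"] False by simp
  then show ?thesis using that(2) by (metis append_take_drop_id)
qed

text \<open>A counterpart of \<open>generic_conc\<close>: the dense sets are copied into the
  cylinder of \<open>u\<close>, and outside of it the claim is vacuous.\<close>

lemma generic_on_cylinder:
  assumes "generic P"
  shows "generic (\<lambda>b. \<forall>a. b = u \<frown> a \<longrightarrow> P a)"
proof -
  from assms obtain S :: "nat \<Rightarrow> bool list set" where S: "\<And>n t. \<exists>r. t @ r \<in> S n"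
    "\<And>a. (\<And>n. \<exists>u\<in>S n. \<exists>b. a = u \<frown> b) \<Longrightarrow> P a"
    by (elim genericE) blast
  \<comment> \<open>The second alternative, incompatibility with \<open>u\<close>, keeps
    \<open>T n\<close> dense off the cylinder.\<close>
  define T where "T n = {w. (\<exists>v\<in>S n. w = u @ v) \<or> (\<forall>a c. w \<frown> a \<noteq> u \<frown> c)}" for n
  show ?thesis
  proof (rule genericI[of T])
    show "\<exists>r. t @ r \<in> T n" for n t
    proof (cases "\<exists>a c. t \<frown> a = u \<frown> c")
      case True
      then obtain a c where "t \<frown> a = u \<frown> c" by blast
      then show ?thesis
      proof (cases rule: conc_eq_cases)
        case (1 v)
        then show ?thesis using S(1)[of v n] by (auto simp: T_def)
      next
        case (2 v)
        obtain r where "[] @ r \<in> S n" using S(1) by blast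
        then show ?thesis using 2 by (intro exI[of _ "v @ r"]) (auto simp: T_def)
      qed
    next
      case False
      then show ?thesis by (intro exI[of _ "[]"]) (auto simp: T_def)
    qed
    fix b assume b: "\<And>n. \<exists>w\<in>T n. \<exists>c. b = w \<frown> c"
    show "\<forall>a. b = u \<frown> a \<longrightarrow> P a"
    proof (intro allI impI)
      fix a assume a: "b = u \<frown> a"
      show "P a"
      proof (rule S(2))
        fix n
        obtain w c where wc: "w \<in> T n" "b = w \<frown> c" using b by blast
        with a obtain v where "v \<in> S n" "w = u @ v" unfolding T_def by auto
        with wc a have "u \<frown> a = u \<frown> (v \<frown> c)" by simp
        then have "a = v \<frown> c" by (simp only: same_concat_eq)
        with \<open>v \<in> S n\<close> show "\<exists>v\<in>S n. \<exists>c. a = v \<frown> c" by blast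
      qed
    qed
  qed
qed

text \<open>Localization: there are only countably many cylinders, so the statements on those where
  \<open>P\<close> holds generically can be intersected, and these cylinders cover a dense open
  set.\<close>

lemma generic_local:
  assumes "\<And>t. \<exists>r. generic (\<lambda>a. P ((t @ r) \<frown> a))"
  shows "generic P"
proof -
  define S where "S = {u. generic (\<lambda>a. P (u \<frown> a))}"
  have "generic (\<lambda>b. u \<in> S \<longrightarrow> (\<forall>a. b = u \<frown> a \<longrightarrow> P (u \<frown> a)))" for u
  proof (cases "u \<in> S")
    case True
    then show ?thesis using generic_on_cylinder[of "\<lambda>a. P (u \<frown> a)" u] by (simp add: S_def)
  next
    case False
    then show ?thesis by (simp add: generic_trivial)
  qed
  then have 1: "generic (\<lambda>b. \<forall>u. u \<in> S \<longrightarrow> (\<forall>a. b = u \<frown> a \<longrightarrow> P (u \<frown> a)))"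
    by (rule generic_all)
  have "generic (\<lambda>b. \<exists>u\<in>S. \<exists>a. b = u \<frown> a)"
    by (rule generic_dense) (use assms in \<open>simp add: S_def\<close>)
  from generic_conj[OF 1 this] show ?thesis
    by (rule generic_mono) blast
qed

lemma chain_limit:
  fixes s :: "nat \<Rightarrow> bool list"
  assumes "\<And>n. \<exists>r. s (Suc n) = s n @ r"
  obtains x where "\<And>n. \<exists>b. x = s n \<frown> b"
proof
  have mono: "\<exists>r. s n = s m @ r" if "m \<le> n" for m n
    using that
  proof (induction n rule: dec_induct)
    case (step n)
    obtain r r' where "s n = s m @ r" "s (Suc n) = s n @ r'" using step.IH assms[of n] by blast
    then show ?case by simp
  qed simp
  \<comment> \<open>The lengths of the \<open>s n\<close> may be bounded; past them
    \<open>x k\<close> is an unspecified value, about which nothing is claimed.\<close>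
  define x where "x k = (let n = (SOME n. k < length (s n)) in s n ! k)" for k
  have x: "x k = s n ! k" if "k < length (s n)" for k n
  proof -
    define m where "m = (SOME n. k < length (s n))"
    have "k < length (s m)" unfolding m_def using that by (rule someI)
    then have "s m ! k = s n ! k"
      using that mono[of m n] mono[of n m] by (metis nle_le nth_append)
    then show ?thesis by (simp add: x_def m_def[symmetric])
  qed
  show "\<exists>b. x = s n \<frown> b" for n
  proof
    show "x = s n \<frown> suffix (length (s n)) x" by (auto simp: conc_def x)
  qed
qed

text \<open>The Baire category theorem for Cantor space: a chain of strings enters the dense sets
  one after the other, and its limit passes through all of them.\<close>

lemma generic_nonempty:
  assumes "generic P"
  obtains a where "P a"
proof -
  from assms obtain S :: "nat \<Rightarrow> bool list set" where S: "\<And>n t. \<exists>r. t @ r \<in> S n"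
    "\<And>a. (\<And>n. \<exists>u\<in>S n. \<exists>b. a = u \<frown> b) \<Longrightarrow> P a"
    by (elim genericE) blast
  have "\<exists>s. \<forall>n. True \<and> ((\<exists>r. s (Suc n) = s n @ r) \<and> s (Suc n) \<in> S n)"
  proof (rule dependent_nat_choice)
    fix t n
    obtain r where "t @ r \<in> S n" using S(1) by blast
    then show "\<exists>y. True \<and> (\<exists>r. y = t @ r) \<and> y \<in> S n" by blast
  qed simp
  then obtain s where s: "\<And>n. \<exists>r. s (Suc n) = s n @ r" "\<And>n. s (Suc n) \<in> S n" by auto
  obtain x where "\<And>n. \<exists>b. x = s n \<frown> b" using s(1) by (rule chain_limit) blast
  then have "P x" by (intro S(2)) (use s(2) in blast)
  then show ?thesis by (rule that)
qed

section \<open>Open and Borel sets, and the Baire property\<close>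

lemma open_cylinder:
  fixes U :: "(nat \<Rightarrow> bool) set"
  assumes "open U" "x \<in> U"
  obtains k where "\<And>y. (\<And>i. i < k \<Longrightarrow> y i = x i) \<Longrightarrow> y \<in> U"
proof -
  have "openin (product_topology (\<lambda>_. euclidean) UNIV) U"
    using assms(1) by (simp add: euclidean_product_topology)
  from product_topology_open_contains_basis[OF this assms(2)]
  obtain X where X: "x \<in> Pi\<^sub>E UNIV X" "finite {i. X i \<noteq> UNIV}" "Pi\<^sub>E UNIV X \<subseteq> U"
    by auto
  from X(2) obtain k where k: "\<And>i. X i \<noteq> UNIV \<Longrightarrow> i < k"
    unfolding finite_nat_set_iff_bounded by auto
  show ?thesis
  proof (rule that)
    fix y assume y: "\<And>i. i < k \<Longrightarrow> y i = x i"
    have "y i \<in> X i" for i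
      using y[of i] k[of i] X(1) by (cases "i < k") (auto simp: PiE_def Pi_def)
    then show "y \<in> U" using X(3) by (auto simp: PiE_def Pi_def)
  qed
qed

text \<open>The form of the Baire property of Borel sets that is needed here.\<close>

lemma borel_generic_decided:
  fixes B :: "(nat \<Rightarrow> bool) set"
  assumes "B \<in> sets borel"
  obtains r where "generic (\<lambda>a. (t @ r) \<frown> a \<in> B)" | r where "generic (\<lambda>a. (t @ r) \<frown> a \<notin> B)"
proof -
  have "\<forall>t. \<exists>r. generic (\<lambda>a. (t @ r) \<frown> a \<in> B) \<or> generic (\<lambda>a. (t @ r) \<frown> a \<notin> B)"
    using assms unfolding sets_borel
  proof (induction rule: sigma_sets.induct)
    case (Basic U)
    then have U: "open U" by simp
    show ?case
    proof
      fix t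
      show "\<exists>r. generic (\<lambda>a. (t @ r) \<frown> a \<in> U) \<or> generic (\<lambda>a. (t @ r) \<frown> a \<notin> U)"
      proof (cases "\<exists>a. t \<frown> a \<in> U")
        case True
        then obtain a where a: "t \<frown> a \<in> U" by blast
        obtain k where k: "\<And>y. (\<And>i. i < k \<Longrightarrow> y i = (t \<frown> a) i) \<Longrightarrow> y \<in> U"
          using open_cylinder[OF U a] by blast
        have "(t @ Omega_Words_Fun.prefix k a) \<frown> b \<in> U" for b
          by (rule k) (auto simp: conc_def nth_append)
        then show ?thesis using generic_trivial by blast
      next
        case False
        then have "generic (\<lambda>a. (t @ []) \<frown> a \<notin> U)" by (intro generic_trivial) simp
        then show ?thesis by blast
      qed
    qed
  next
    case Empty
    show ?case by (simp add: generic_trivial)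
  next
    case (Compl B)
    then show ?case by (auto simp: disj_commute)
  next
    case (Union B)
    have IH: "\<exists>r. generic (\<lambda>a. (t @ r) \<frown> a \<in> B i) \<or> generic (\<lambda>a. (t @ r) \<frown> a \<notin> B i)" for t i
      using Union.IH by blast
    show ?case
    proof (intro allI, rule ccontr)
      fix t
      assume no: "\<nexists>r. generic (\<lambda>a. (t @ r) \<frown> a \<in> (\<Union>i. B i)) \<or> generic (\<lambda>a. (t @ r) \<frown> a \<notin> (\<Union>i. B i))"
      \<comment> \<open>If the union is generic on no cylinder below \<open>t\<close>, neither is
        any \<open>B i\<close>, so by induction \<open>B i\<close> is generically avoided on densely
        many cylinders. These are glued by \<open>generic_local\<close>, and then all
        \<open>i\<close> are combined.\<close>
      have "\<not> generic (\<lambda>a. (t @ r) \<frown> a \<in> B i)" for i r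
        using no generic_mono[of "\<lambda>a. (t @ r) \<frown> a \<in> B i" "\<lambda>a. (t @ r) \<frown> a \<in> (\<Union>i. B i)"] by blast
      then have "\<exists>r'. generic (\<lambda>a. t \<frown> ((r @ r') \<frown> a) \<notin> B i)" for i r
        using IH[of "t @ r" i] by simp
      then have "generic (\<lambda>a. t \<frown> a \<notin> B i)" for i
        by (rule generic_local)
      then have "generic (\<lambda>a. \<forall>i. t \<frown> a \<notin> B i)" by (rule generic_all)
      then have "generic (\<lambda>a. (t @ []) \<frown> a \<notin> (\<Union>i. B i))" by simp
      then show False using no by blast
    qed
  qed
  then show ?thesis using that by blast
qed

text \<open>By the Baire category theorem the cases cannot all be generically avoided; a case that
  is not avoided holds generically on some cylinder, by the Baire property.\<close>

lemma generic_countable_cases: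
  fixes P :: "'k::countable \<Rightarrow> (nat \<Rightarrow> bool) \<Rightarrow> bool"
  assumes "\<And>k. {a. P k a} \<in> sets borel" "generic (\<lambda>a. \<exists>k. P k a)"
  obtains k r where "generic (\<lambda>a. P k (r \<frown> a))"
proof (rule ccontr)
  assume "\<not> thesis"
  then have no: "\<not> generic (\<lambda>a. P k (r \<frown> a))" for k r using that by blast
  have "\<exists>r. generic (\<lambda>a. \<not> P k ((t @ r) \<frown> a))" for k t
  proof (cases rule: borel_generic_decided[OF assms(1), of t k])
    case (1 r)
    with no[of k "t @ r"] show ?thesis by simp
  next
    case (2 r)
    then show ?thesis by auto
  qed
  then have "generic (\<lambda>a. \<not> P k a)" for k by (rule generic_local)
  then have "generic (\<lambda>a. \<forall>k. \<not> P k a)" by (rule generic_all)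
  from generic_conj[OF this assms(2)] show False by (rule generic_nonempty) blast
qed

section \<open>\<open>E0\<close> and its Borel reductions to itself\<close>

text \<open>Every \<open>E0\<close>-class is meager: each string extends to one that differs from
  \<open>a\<close> at a position beyond \<open>n\<close>.\<close>

lemma generic_not_E0: "generic (\<lambda>b. (a, b) \<notin> E0)"
proof -
  have "generic (\<lambda>b. \<exists>u\<in>{u. \<exists>k>n. k < length u \<and> a k \<noteq> u ! k}. \<exists>c. b = u \<frown> c)" for n
  proof (rule generic_dense)
    fix t :: "bool list"
    \<comment> \<open>Beyond \<open>n\<close> and not inside \<open>t\<close>, so that padding
      \<open>t\<close> with \<open>False\<close> and appending the flipped letter puts the
      difference exactly at \<open>k\<close>.\<close>
    define k where "k = max (Suc n) (length t)"
    show "\<exists>r. t @ r \<in> {u. \<exists>k>n. k < length u \<and> a k \<noteq> u ! k}"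
      by (rule exI[of _ "replicate (k - length t) False @ [\<not> a k]"])
         (auto simp: nth_append k_def intro!: exI[of _ k])
  qed
  then have "generic (\<lambda>b. \<forall>n. \<exists>u\<in>{u. \<exists>k>n. k < length u \<and> a k \<noteq> u ! k}. \<exists>c. b = u \<frown> c)"
    by (rule generic_all)
  then show ?thesis
    by (rule generic_mono) (fastforce simp: E0_def)
qed

definition E0_reduction :: "((nat \<Rightarrow> bool) \<Rightarrow> (nat \<Rightarrow> bool)) \<Rightarrow> bool" where
  "E0_reduction h \<longleftrightarrow> h \<in> borel_measurable borel \<and> (\<forall>a b. (a, b) \<in> E0 \<longleftrightarrow> (h a, h b) \<in> E0)"

lemma E0_iff_suffix: "(a, b) \<in> E0 \<longleftrightarrow> (\<exists>n. suffix n a = suffix n b)"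
proof
  assume "(a, b) \<in> E0"
  then obtain n where "\<forall>k>n. a k = b k" by (auto simp: E0_def)
  then have "suffix (Suc n) a = suffix (Suc n) b" by (auto simp: suffix_def)
  then show "\<exists>n. suffix n a = suffix n b" by blast
next
  assume "\<exists>n. suffix n a = suffix n b"
  then obtain n where n: "\<And>k. a (n + k) = b (n + k)" by (metis suffix_nth)
  have "a k = b k" if "k > n" for k using n[of "k - n"] that by simp
  then show "(a, b) \<in> E0" by (auto simp: E0_def)
qed

lemma E0_suffix_iff [simp]: "(suffix m a, suffix m b) \<in> E0 \<longleftrightarrow> (a, b) \<in> E0"
proof
  assume "(a, b) \<in> E0"
  then obtain n where "suffix n a = suffix n b" by (auto simp: E0_iff_suffix)
  then have "suffix m (suffix n a) = suffix m (suffix n b)" by simp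
  then show "(suffix m a, suffix m b) \<in> E0" by (auto simp: E0_iff_suffix add.commute)
qed (auto simp: E0_iff_suffix)

lemma E0_conc:
  assumes "length s = length t" "(a, b) \<in> E0"
  shows "(s \<frown> a, t \<frown> b) \<in> E0"
proof -
  have "(suffix (length s) (s \<frown> a), suffix (length s) (t \<frown> b)) \<in> E0"
    using assms by (simp del: E0_suffix_iff)
  then show ?thesis by (simp only: E0_suffix_iff)
qed

lemma E0_conc_iff [simp]: "(s \<frown> a, s \<frown> b) \<in> E0 \<longleftrightarrow> (a, b) \<in> E0"
  by (metis E0_suffix_iff suffix_conc_length)

lemma borel_measurable_conc [measurable]: "(\<lambda>a::nat \<Rightarrow> bool. t \<frown> a) \<in> borel_measurable borel"
proof (rule borel_measurable_continuous_onI, rule continuous_on_coordinatewise_then_product)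
  show "continuous_on UNIV (\<lambda>a::nat \<Rightarrow> bool. (t \<frown> a) n)" for n
    by (cases "n < length t") (auto intro: continuous_on_product_coordinates)
qed

lemma borel_measurable_suffix [measurable]: "(\<lambda>a::nat \<Rightarrow> bool. suffix m a) \<in> borel_measurable borel"
proof (rule borel_measurable_continuous_onI, rule continuous_on_coordinatewise_then_product)
  show "continuous_on UNIV (\<lambda>a::nat \<Rightarrow> bool. suffix m a n)" for n
    by (auto intro: continuous_on_product_coordinates)
qed

lemma pred_coordinate:
  fixes h :: "(nat \<Rightarrow> bool) \<Rightarrow> (nat \<Rightarrow> bool)"
  assumes "h \<in> borel_measurable borel"
  shows "Measurable.pred borel (\<lambda>a. h a n)"
proof -
  have "open ((\<lambda>x::nat \<Rightarrow> bool. x n) -` {True})"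
    by (rule open_vimage) (auto simp: open_discrete intro: continuous_on_product_coordinates)
  then have [measurable]: "{x::nat \<Rightarrow> bool. x n} \<in> sets borel" by (simp add: vimage_def)
  show ?thesis
    using measurable_sets_borel[OF assms, of "{x. x n}"] by (simp add: pred_def vimage_def)
qed

text \<open>Prepending a fixed string and deleting a fixed number of letters both preserve and
  reflect \<open>E0\<close>. So tail maps are reductions again, which lets the splitting be
  iterated.\<close>

lemma E0_reduction_shift:
  assumes "E0_reduction h"
  shows "E0_reduction (\<lambda>a. suffix m (h (t \<frown> a)))"
proof -
  have [measurable]: "h \<in> borel_measurable borel" using assms by (simp add: E0_reduction_def)
  have "(\<lambda>a. suffix m (h (t \<frown> a))) \<in> borel_measurable borel" by measurable
  with assms show ?thesis unfolding E0_reduction_def by (metis E0_suffix_iff E0_conc_iff)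
qed

text \<open>The preimage of a point under a reduction lies in a single \<open>E0\<close>-class,
  which is meager.\<close>

lemma E0_reduction_not_generically_constant:
  assumes "E0_reduction h"
  shows "\<not> generic (\<lambda>a. h a = c)"
proof
  assume c: "generic (\<lambda>a. h a = c)"
  obtain a where a: "h a = c" using c by (rule generic_nonempty)
  from generic_conj[OF c generic_not_E0[of a]]
  obtain b where "h b = c" "(a, b) \<notin> E0" by (rule generic_nonempty) blast
  then have "(c, c) \<notin> E0" using assms a by (metis E0_reduction_def)
  then show False by (simp add: E0_iff_suffix)
qed

text \<open>A zero-one law: a Borel map that is generically invariant under exchanging initial
  segments of equal length has generically constant coordinates, so it is generically constant,
  which a reduction is not.\<close>

lemma E0_reduction_not_shift_invariant:
  assumes h: "E0_reduction h"
  shows "\<exists>s t. length s = length t \<and> \<not> generic (\<lambda>a. h (s \<frown> a) = h (t \<frown> a))"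
proof (rule ccontr)
  assume "\<not> ?thesis"
  then have inv: "generic (\<lambda>a. h (s \<frown> a) = h (t \<frown> a))" if "length s = length t" for s t
    using that by blast
  have "\<exists>c. generic (\<lambda>a. h a n = c)" for n
  proof -
    have "{a. h a n} \<in> sets borel"
      using pred_coordinate[of h n] h by (simp add: E0_reduction_def pred_def)
    then obtain r c where rc: "generic (\<lambda>a. h (r \<frown> a) n = c)"
    proof (cases rule: borel_generic_decided[where t = "[]"])
      case (1 r)
      then show ?thesis using that[of r True] by simp
    next
      case (2 r)
      then show ?thesis using that[of r False] by simp
    qed
    have "generic (\<lambda>a. h a n = c)"
    proof (rule generic_local)
      fix t :: "bool list"
      \<comment> \<open>Padding by zeros gives \<open>t\<close> and \<open>r\<close> extensions of
        equal length, between which the invariance transfers the value \<open>c\<close>.\<close>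
      define z where "z k = replicate k False" for k
      have 1: "generic (\<lambda>a. h ((t @ z (length r)) \<frown> a) = h ((r @ z (length t)) \<frown> a))"
        by (rule inv) (simp add: z_def)
      have 2: "generic (\<lambda>a. h ((r @ z (length t)) \<frown> a) n = c)"
        using generic_conc[OF rc, of "z (length t)"] by simp
      have "generic (\<lambda>a. h ((t @ z (length r)) \<frown> a) n = c)"
        by (rule generic_mono[OF generic_conj[OF 1 2]]) simp
      then show "\<exists>r. generic (\<lambda>a. h ((t @ r) \<frown> a) n = c)" by blast
    qed
    then show ?thesis by blast
  qed
  then obtain c where "\<And>n. generic (\<lambda>a. h a n = c n)" by metis
  then have "generic (\<lambda>a. \<forall>n. h a n = c n)" by (rule generic_all)
  then have "generic (\<lambda>a. h a = c)" by (simp add: fun_eq_iff)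
  with E0_reduction_not_generically_constant[OF h] show False by blast
qed

text \<open>Prefixes \<open>s\<close>, \<open>t\<close> of equal length before the same tail give
  \<open>E0\<close>-equivalent arguments, so the values differ in finitely many places only. There
  are countably many possible pairs of differing initial segments, and one of them occurs
  generically on a cylinder.\<close>

lemma E0_reduction_splits:
  assumes h: "E0_reduction h"
  obtains e w :: "bool \<Rightarrow> bool list" where "length (w False) = length (w True)"
    "w False \<noteq> w True" "generic (\<lambda>a. \<exists>b. \<forall>i. h (e i \<frown> a) = w i \<frown> b)"
proof -
  obtain s0 t0 where st0: "length s0 = length t0" "\<not> generic (\<lambda>a. h (s0 \<frown> a) = h (t0 \<frown> a))"
    using E0_reduction_not_shift_invariant[OF h] by blast
  have [measurable]: "h \<in> borel_measurable borel" using h by (simp add: E0_reduction_def)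
  have P [measurable]: "Measurable.pred borel (\<lambda>a. h (t \<frown> a) n)" for t n
    by (rule pred_coordinate) measurable
  have eq_borel: "{a. h (s0 \<frown> a) = h (t0 \<frown> a)} \<in> sets borel"
  proof -
    have "Measurable.pred borel (\<lambda>a. \<forall>n. h (s0 \<frown> a) n = h (t0 \<frown> a) n)" by measurable
    then show ?thesis by (simp add: pred_def fun_eq_iff)
  qed
  \<comment> \<open>As equality is not generic, \<open>generic_local\<close> gives a
    \<open>v\<close> with no extension on whose cylinder it is generic. Equality is a Borel
    condition, so inequality is generic on the cylinder of some extension of
    \<open>v\<close>.\<close>
  obtain u where u: "generic (\<lambda>a. h (s0 \<frown> (u \<frown> a)) \<noteq> h (t0 \<frown> (u \<frown> a)))"
  proof -
    obtain v where v: "\<And>r. \<not> generic (\<lambda>a. h (s0 \<frown> ((v @ r) \<frown> a)) = h (t0 \<frown> ((v @ r) \<frown> a)))"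
      using generic_local[of "\<lambda>a. h (s0 \<frown> a) = h (t0 \<frown> a)"] st0(2) by blast
    show ?thesis
      using borel_generic_decided[OF eq_borel, of v]
    proof cases
      case (1 r)
      with v[of r] show ?thesis by simp
    next
      case (2 r)
      with that[of "v @ r"] show ?thesis by simp
    qed
  qed
  define s where "s = s0 @ u"
  define t where "t = t0 @ u"
  \<comment> \<open>The values on the two sides begin with \<open>w0\<close> and \<open>w1\<close>
    and coincide afterwards; stating this by coordinates makes it a Borel condition.\<close>
  define Q where "Q k a = (case k of (w0, w1) \<Rightarrow> length w0 = length w1 \<and> w0 \<noteq> w1 \<and>
      (\<forall>n. if n < length w0 then h (s \<frown> a) n = w0 ! n \<and> h (t \<frown> a) n = w1 ! n
           else h (s \<frown> a) n = h (t \<frown> a) n))" for k :: "bool list \<times> bool list" and a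
  have len: "length s = length t" using st0 by (simp add: s_def t_def)
  have ne: "generic (\<lambda>a. h (s \<frown> a) \<noteq> h (t \<frown> a))" using u by (simp add: s_def t_def)
  have "generic (\<lambda>a. \<exists>k. Q k a)"
  proof (rule generic_mono[OF ne])
    fix a assume ne: "h (s \<frown> a) \<noteq> h (t \<frown> a)"
    have "(s \<frown> a, t \<frown> a) \<in> E0"
      by (rule E0_conc[OF len]) (simp add: E0_iff_suffix)
    then have "(h (s \<frown> a), h (t \<frown> a)) \<in> E0" using h by (metis E0_reduction_def)
    then obtain m where m: "\<And>k. k > m \<Longrightarrow> h (s \<frown> a) k = h (t \<frown> a) k" by (auto simp: E0_def)
    obtain n where n: "h (s \<frown> a) n \<noteq> h (t \<frown> a) n" using ne by (auto simp: fun_eq_iff)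
    then have "n \<le> m" using m by (meson not_le)
    \<comment> \<open>Length \<open>Suc m\<close> covers the difference at \<open>n\<close>, and
      from there on the values agree.\<close>
    define p where "p x = map x [0..<Suc m]" for x :: "nat \<Rightarrow> bool"
    have len_p: "length (p x) = Suc m" and nth_p: "k \<le> m \<Longrightarrow> p x ! k = x k" for x k
      by (auto simp: p_def simp del: upt_Suc)
    have "p (h (s \<frown> a)) \<noteq> p (h (t \<frown> a))"
      using n \<open>n \<le> m\<close> nth_p by metis
    then have "Q (p (h (s \<frown> a)), p (h (t \<frown> a))) a"
      using m by (auto simp: Q_def len_p nth_p)
    then show "\<exists>k. Q k a" by blast
  qed
  moreover have "{a. Q k a} \<in> sets borel" for k
  proof -
    obtain w0 w1 where k: "k = (w0, w1)" by (cases k)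
    have [measurable]: "Measurable.pred borel
      (\<lambda>a. if n < length w0 then h (s \<frown> a) n = w0 ! n \<and> h (t \<frown> a) n = w1 ! n
           else h (s \<frown> a) n = h (t \<frown> a) n)" for n
      by (cases "n < length w0") simp_all
    have "Measurable.pred borel (Q k)" unfolding Q_def k prod.case by measurable
    then show ?thesis by (simp add: pred_def)
  qed
  ultimately obtain k r where kr: "generic (\<lambda>a. Q k (r \<frown> a))"
    using generic_countable_cases[of Q] by blast
  obtain w0 w1 where k: "k = (w0, w1)" by (cases k)
  \<comment> \<open>The requirements on \<open>k\<close> alone in \<open>Q\<close> do not depend on
    the point, so one point yields them.\<close>
  obtain a where "Q k (r \<frown> a)" using kr by (rule generic_nonempty)
  then have w: "length w0 = length w1" "w0 \<noteq> w1" by (auto simp: Q_def k)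
  define e where "e i = (if i then t else s) @ r" for i
  define v where "v i = (if i then w1 else w0)" for i
  have "generic (\<lambda>a. \<exists>b. \<forall>i. h (e i \<frown> a) = v i \<frown> b)"
  proof (rule generic_mono[OF kr])
    fix a assume "Q k (r \<frown> a)"
    then have Q: "if n < length w0 then h (s \<frown> r \<frown> a) n = w0 ! n \<and> h (t \<frown> r \<frown> a) n = w1 ! n
           else h (s \<frown> r \<frown> a) n = h (t \<frown> r \<frown> a) n" for n
      unfolding Q_def k prod.case by blast
    have "h (e i \<frown> a) = v i \<frown> suffix (length w0) (h (s \<frown> r \<frown> a))" for i
    proof
      fix n
      show "h (e i \<frown> a) n = (v i \<frown> suffix (length w0) (h (s \<frown> r \<frown> a))) n"
        using Q[of n] w(1) by (cases "n < length w0"; cases i) (auto simp: e_def v_def)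
    qed
    then show "\<exists>b. \<forall>i. h (e i \<frown> a) = v i \<frown> b" by blast
  qed
  then show ?thesis using w by (intro that[of v e]) (auto simp: v_def)
qed

section \<open>The fusion step\<close>

text \<open>The strings are treated one at a time; a string that already passes through
  \<open>S\<close> continues to do so when the common extension grows.\<close>

lemma dense_common_extension:
  fixes S :: "'a list set"
  assumes "finite T" and dense: "\<And>t. \<exists>r. t @ r \<in> S"
  shows "\<exists>r. \<forall>t\<in>T. \<exists>u\<in>S. \<exists>v. t @ r = u @ v"
  using assms(1)
proof induction
  case (insert t T)
  then obtain r where r: "\<And>t. t \<in> T \<Longrightarrow> \<exists>u\<in>S. \<exists>v. t @ r = u @ v" by blast
  obtain r' where r': "(t @ r) @ r' \<in> S" using dense by blast
  have "\<exists>u\<in>S. \<exists>v. t' @ r @ r' = u @ v" if "t' \<in> insert t T" for t'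
  proof (cases "t' = t")
    case True
    with r' show ?thesis by (metis append.assoc append_Nil2)
  next
    case False
    with that r[of t'] show ?thesis by (metis append.assoc insertE)
  qed
  then show ?case by blast
qed simp

text \<open>The generic values at all nodes of length \<open>n\<close> share one tail, so splitting
  this tail at a single node splits it at every node with the same pair \<open>w\<close>.\<close>

lemma E0_reduction_extend:
  fixes E W :: "bool list \<Rightarrow> bool list"
  assumes f: "E0_reduction f"
    and gen: "generic (\<lambda>a. \<exists>b. \<forall>\<sigma>. length \<sigma> = n \<longrightarrow> f (E \<sigma> \<frown> a) = W \<sigma> \<frown> b)"
    and dense: "\<And>t. \<exists>r. t @ r \<in> S"
  obtains e w :: "bool \<Rightarrow> bool list" where "length (w False) = length (w True)"
    "w False \<noteq> w True"
    "generic (\<lambda>a. \<exists>b. \<forall>\<sigma> i. length \<sigma> = n \<longrightarrow> f ((E \<sigma> @ e i) \<frown> a) = (W \<sigma> @ w i) \<frown> b)"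
    "\<And>\<sigma> i. length \<sigma> = n \<Longrightarrow> \<exists>u\<in>S. \<exists>v. E \<sigma> @ e i = u @ v"
proof -
  \<comment> \<open>A sample node, through which the common tail is expressed as a reduction
    \<open>h\<close>.\<close>
  define \<sigma>0 where "\<sigma>0 = replicate n False"
  define h where "h a = suffix (length (W \<sigma>0)) (f (E \<sigma>0 \<frown> a))" for a
  have "E0_reduction h" unfolding h_def using f by (rule E0_reduction_shift)
  then obtain e0 w :: "bool \<Rightarrow> bool list" where w: "length (w False) = length (w True)"
    "w False \<noteq> w True" and e0: "generic (\<lambda>a. \<exists>b. \<forall>i. h (e0 i \<frown> a) = w i \<frown> b)"
    using E0_reduction_splits by blast
  \<comment> \<open>The finitely many new argument strings; one common \<open>r\<close> makes all of
    them pass through \<open>S\<close>.\<close>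
  define T where "T = (\<lambda>(\<sigma>, i). E \<sigma> @ e0 i) ` ({\<sigma>. set \<sigma> \<subseteq> UNIV \<and> length \<sigma> = n} \<times> UNIV)"
  have "finite T" unfolding T_def by (intro finite_imageI finite_cartesian_product finite_lists_length_eq) auto
  from dense_common_extension[OF this dense]
  obtain r where r: "\<And>t. t \<in> T \<Longrightarrow> \<exists>u\<in>S. \<exists>v. t @ r = u @ v" by auto
  define e where "e i = e0 i @ r" for i
  have "\<exists>u\<in>S. \<exists>v. E \<sigma> @ e i = u @ v" if "length \<sigma> = n" for \<sigma> i
    using r[of "E \<sigma> @ e0 i"] that by (force simp: T_def e_def)
  moreover
  \<comment> \<open>Here the tail may still depend on \<open>i\<close>. Evaluation at
    \<open>\<sigma>0\<close> identifies it with \<open>h (e i \<frown> a)\<close>, which the next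
    statement splits into \<open>w i\<close> and a tail independent of \<open>i\<close>.\<close>
  have 1: "generic (\<lambda>a. \<forall>i. \<exists>b. \<forall>\<sigma>. length \<sigma> = n \<longrightarrow> f (E \<sigma> \<frown> (e i \<frown> a)) = W \<sigma> \<frown> b)"
    by (rule generic_all) (rule generic_conc[OF gen])
  have 2: "generic (\<lambda>a. \<exists>b. \<forall>i. h (e i \<frown> a) = w i \<frown> b)"
    using generic_conc[OF e0, of r] by (simp add: e_def)
  have "generic (\<lambda>a. \<exists>b. \<forall>\<sigma> i. length \<sigma> = n \<longrightarrow> f ((E \<sigma> @ e i) \<frown> a) = (W \<sigma> @ w i) \<frown> b)"
  proof (rule generic_mono[OF generic_conj[OF 1 2]], elim conjE)
    fix a assume 1: "\<forall>i. \<exists>b. \<forall>\<sigma>. length \<sigma> = n \<longrightarrow> f (E \<sigma> \<frown> (e i \<frown> a)) = W \<sigma> \<frown> b"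
      and "\<exists>b. \<forall>i. h (e i \<frown> a) = w i \<frown> b"
    then obtain b where b: "\<And>i. h (e i \<frown> a) = w i \<frown> b" by blast
    have "f ((E \<sigma> @ e i) \<frown> a) = (W \<sigma> @ w i) \<frown> b" if \<sigma>: "length \<sigma> = n" for \<sigma> i
    proof -
      obtain b' where b': "\<And>\<sigma>. length \<sigma> = n \<Longrightarrow> f (E \<sigma> \<frown> (e i \<frown> a)) = W \<sigma> \<frown> b'"
        using 1 by blast
      have "h (e i \<frown> a) = b'"
        using b'[of \<sigma>0] unfolding h_def by (simp add: \<sigma>0_def)
      with b[of i] b'[OF \<sigma>] show ?thesis by simp
    qed
    then show "\<exists>b. \<forall>\<sigma> i. length \<sigma> = n \<longrightarrow> f ((E \<sigma> @ e i) \<frown> a) = (W \<sigma> @ w i) \<frown> b" by blast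
  qed
  ultimately show ?thesis using w that by blast
qed

section \<open>Positions in the blocks of a tree\<close>

text \<open>The position at which the \<open>n\<close>-th block begins. When the two strings of each
  block have equal length, it is the same on all branches, and \<open>v i False\<close> can
  represent both.\<close>

definition block_start :: "bool list \<Rightarrow> (nat \<Rightarrow> bool \<Rightarrow> bool list) \<Rightarrow> nat \<Rightarrow> nat" where
  "block_start s v n = length s + (\<Sum>i<n. length (v i False))"

lemma length_E0_string_eq:
  assumes "\<And>n. length (v n False) = length (v n True)"
  shows "length (E0_string s v (map x [0..<n])) = block_start s v n"
proof (induction n)
  case (Suc n)
  have "length (v n (x n)) = length (v n False)" using assms by (cases "x n") auto
  with Suc show ?case by (simp only: E0_string_Suc length_append block_start_def sum.lessThan_Suc)
qed (simp add: block_start_def E0_string_def)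

lemma block_start_ge:
  assumes "\<And>n i. v n i \<noteq> []"
  shows "n \<le> block_start s v n"
proof (induction n)
  case (Suc n)
  have "length (v n False) > 0" using assms by simp
  with Suc.IH show ?case unfolding block_start_def sum.lessThan_Suc by linarith
qed simp

lemma canonical_map_stem:
  assumes "k < length s"
  shows "canonical_map s v x k = s ! k"
  using canonical_map_eq[of k s v x 0] assms by (simp add: E0_string_def)

lemma canonical_map_block:
  assumes len: "\<And>n. length (v n False) = length (v n True)" and "j < length (v n False)"
  shows "canonical_map s v x (block_start s v n + j) = v n (x n) ! j"
proof -
  have j: "j < length (v n (x n))" using assms by (cases "x n") auto
  have "canonical_map s v x (block_start s v n + j) =
      E0_string s v (map x [0..<Suc n]) ! (block_start s v n + j)"
    by (rule canonical_map_eq) (unfold E0_string_Suc length_append length_E0_string_eq[of v, OF len], use j in simp)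
  also have "\<dots> = v n (x n) ! j"
    unfolding E0_string_Suc by (simp add: nth_append length_E0_string_eq[of v, OF len])
  finally show ?thesis .
qed

lemma block_cases:
  assumes "\<And>n i. v n i \<noteq> []"
  obtains "k < length s"
  | n j where "k = block_start s v n + j" "j < length (v n False)"
proof (cases "k < length s")
  case False
  \<comment> \<open>The block just before the first one that starts beyond \<open>k\<close> contains
    \<open>k\<close>.\<close>
  define m where "m = (LEAST m. k < block_start s v m)"
  have ex: "k < block_start s v (Suc k)"
    using block_start_ge[of v "Suc k" s, OF assms] by simp
  have km: "k < block_start s v m" unfolding m_def using ex by (rule LeastI)
  have "m \<noteq> 0" using km False by (auto simp: block_start_def intro!: gr0I)
  then obtain n where n: "m = Suc n" by (cases m) auto
  have "\<not> k < block_start s v n" using not_less_Least[of n "\<lambda>m. k < block_start s v m"] n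
    by (simp add: m_def)
  with km n that(2)[of n "k - block_start s v n"] show ?thesis by (simp add: block_start_def)
qed (use that in simp)

text \<open>Every block on which \<open>x\<close> and \<open>y\<close> choose differently contains a
  position of difference, and the \<open>n\<close>-th block starts no earlier than
  \<open>n\<close>.\<close>

lemma canonical_map_not_E0:
  assumes len: "\<And>n. length (v n False) = length (v n True)"
    and ne: "\<And>n. v n False \<noteq> v n True" "\<And>n i. v n i \<noteq> []"
    and diff: "\<And>N. \<exists>n>N. x n \<noteq> y n"
  shows "(canonical_map s v x, canonical_map s v y) \<notin> E0"
proof
  assume "(canonical_map s v x, canonical_map s v y) \<in> E0"
  then obtain N where N: "\<And>k. k > N \<Longrightarrow> canonical_map s v x k = canonical_map s v y k"
    by (auto simp: E0_def)
  obtain n where n: "n > N" "x n \<noteq> y n" using diff by blast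
  obtain j where j: "j < length (v n False)" "v n False ! j \<noteq> v n True ! j"
    using ne(1) len by (metis nth_equalityI)
  have "v n (x n) ! j = v n (y n) ! j"
    using N[of "block_start s v n + j"] block_start_ge[of v n s, OF ne(2)] n
      canonical_map_block[of v j n s, OF len j(1)] by simp
  with n j show False by (cases "x n"; cases "y n") auto
qed

section \<open>The fusion construction\<close>

text \<open>This differs from an \<open>E\<^sub>0\<close>-tree in that the two strings of a block need not differ at their
  first letter.\<close>

lemma E0_reduction_tree:
  assumes f: "E0_reduction f"
  obtains s v where "\<And>n. length (v n False) = length (v n True)" "\<And>n. v n False \<noteq> v n True"
    "\<And>x. canonical_map s v x \<in> range f"
proof -
  \<comment> \<open>One sequence of dense sets forces all generic statements on initial segments of values at once.\<close>
  define G where "G t s \<longleftrightarrow> generic (\<lambda>a. \<exists>b. f (t \<frown> a) = s \<frown> b)" for t s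
  have "generic (\<lambda>x. \<forall>k. G (fst k) (snd k) \<longrightarrow> (\<forall>a. x = fst k \<frown> a \<longrightarrow> (\<exists>b. f (fst k \<frown> a) = snd k \<frown> b)))"
  proof (rule generic_all)
    fix k
    show "generic (\<lambda>x. G (fst k) (snd k) \<longrightarrow> (\<forall>a. x = fst k \<frown> a \<longrightarrow> (\<exists>b. f (fst k \<frown> a) = snd k \<frown> b)))"
    proof (cases "G (fst k) (snd k)")
      case True
      then show ?thesis unfolding G_def by (simp add: generic_on_cylinder)
    qed (simp add: generic_trivial)
  qed
  then obtain S :: "nat \<Rightarrow> bool list set" where S: "\<And>n t. \<exists>r. t @ r \<in> S n" and
    "\<And>x. (\<And>n. \<exists>u\<in>S n. \<exists>b. x = u \<frown> b) \<Longrightarrow>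
      \<forall>k. G (fst k) (snd k) \<longrightarrow> (\<forall>a. x = fst k \<frown> a \<longrightarrow> (\<exists>b. f (fst k \<frown> a) = snd k \<frown> b))"
    by (elim genericE) blast
  \<comment> \<open>A point that passes through every \<open>S n\<close> has each initial value that
    is generically forced on a cylinder around it.\<close>
  then have SG: "\<exists>b. f x = s \<frown> b"
    if "\<And>n. \<exists>u\<in>S n. \<exists>b. x = u \<frown> b" "G t s" "x = t \<frown> a" for x t s a
    using that by (metis fst_conv snd_conv)
  \<comment> \<open>\<open>E\<close> and \<open>W\<close> assign argument and value strings to
    nodes. At stage \<open>n\<close> only nodes of length \<open>n\<close> matter, and the invariant
    is that they generically leave the same tail.\<close>
  define Inv :: "nat \<Rightarrow> (bool list \<Rightarrow> bool list) \<Rightarrow> (bool list \<Rightarrow> bool list) \<Rightarrow> bool" where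
    "Inv n E W \<longleftrightarrow> generic (\<lambda>a. \<exists>b. \<forall>\<sigma>. length \<sigma> = n \<longrightarrow> f (E \<sigma> \<frown> a) = W \<sigma> \<frown> b)" for n E W
  define Step where "Step n E W E' W' e w \<longleftrightarrow> length (w False) = length (w True) \<and> w False \<noteq> w True \<and>
      (\<forall>\<sigma> i. length \<sigma> = n \<longrightarrow> E' (\<sigma> @ [i]) = E \<sigma> @ e i \<and> W' (\<sigma> @ [i]) = W \<sigma> @ w i \<and>
         (\<exists>u\<in>S n. \<exists>v. E \<sigma> @ e i = u @ v))"
    for n and E W E' W' :: "bool list \<Rightarrow> bool list" and e w :: "bool \<Rightarrow> bool list"
  have "\<exists>st. \<forall>n. (case st n of (E, W, w) \<Rightarrow> Inv n E W) \<and>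
      (case (st n, st (Suc n)) of ((E, W, w), (E', W', w')) \<Rightarrow> \<exists>e'. Step n E W E' W' e' w')"
  proof (rule dependent_nat_choice)
    have "Inv 0 (\<lambda>_. []) (\<lambda>_. [])" unfolding Inv_def by (rule generic_trivial) auto
    then show "\<exists>x. case x of (E, W, w) \<Rightarrow> Inv 0 E W" by auto
  next
    fix x :: "(bool list \<Rightarrow> bool list) \<times> (bool list \<Rightarrow> bool list) \<times> (bool \<Rightarrow> bool list)" and n
    assume x: "case x of (E, W, w) \<Rightarrow> Inv n E W"
    obtain E W w0 where xE: "x = (E, W, w0)" by (cases x)
    with x have gen: "generic (\<lambda>a. \<exists>b. \<forall>\<sigma>. length \<sigma> = n \<longrightarrow> f (E \<sigma> \<frown> a) = W \<sigma> \<frown> b)"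
      by (simp add: Inv_def)
    obtain e w where ew: "length (w False) = length (w True)" "w False \<noteq> w True"
      "generic (\<lambda>a. \<exists>b. \<forall>\<sigma> i. length \<sigma> = n \<longrightarrow> f ((E \<sigma> @ e i) \<frown> a) = (W \<sigma> @ w i) \<frown> b)"
      "\<And>\<sigma> i. length \<sigma> = n \<Longrightarrow> \<exists>u\<in>S n. \<exists>v. E \<sigma> @ e i = u @ v"
      by (rule E0_reduction_extend[OF f gen S[of _ n]]) (rule that)
    \<comment> \<open>\<open>butlast\<close> and \<open>last\<close> recover the parent and the
      direction of a node of length \<open>Suc n\<close>.\<close>
    define E' where "E' \<tau> = E (butlast \<tau>) @ e (last \<tau>)" for \<tau>
    define W' where "W' \<tau> = W (butlast \<tau>) @ w (last \<tau>)" for \<tau>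
    have "Step n E W E' W' e w" using ew by (auto simp: Step_def E'_def W'_def)
    moreover have "Inv (Suc n) E' W'"
      unfolding Inv_def
    proof (rule generic_mono[OF ew(3)], elim exE)
      fix a b assume b: "\<forall>\<sigma> i. length \<sigma> = n \<longrightarrow> f ((E \<sigma> @ e i) \<frown> a) = (W \<sigma> @ w i) \<frown> b"
      have "f (E' \<tau> \<frown> a) = W' \<tau> \<frown> b" if "length \<tau> = Suc n" for \<tau>
        using b[rule_format, of "butlast \<tau>" "last \<tau>"] that by (simp add: E'_def W'_def)
      then show "\<exists>b. \<forall>\<tau>. length \<tau> = Suc n \<longrightarrow> f (E' \<tau> \<frown> a) = W' \<tau> \<frown> b" by blast
    qed
    ultimately show "\<exists>y. (case y of (E, W, w) \<Rightarrow> Inv (Suc n) E W) \<and>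
        (case (x, y) of ((E, W, w), (E', W', w')) \<Rightarrow> \<exists>e'. Step n E W E' W' e' w')"
      by (intro exI[of _ "(E', W', w)"]) (auto simp: xE)
  qed
  then obtain st where st: "\<forall>n. (case st n of (E, W, w) \<Rightarrow> Inv n E W) \<and>
      (case (st n, st (Suc n)) of ((E, W, w), (E', W', w')) \<Rightarrow> \<exists>e'. Step n E W E' W' e' w')"
    by (elim exE) (rule that)
  define E where "E n = fst (st n)" for n
  define W where "W n = fst (snd (st n))" for n
  \<comment> \<open>The third component at stage \<open>Suc n\<close> is the pair of value strings
    chosen in the passage from \<open>n\<close>; the one at stage 0 is arbitrary, hence the
    shift.\<close>
  define v where "v n = snd (snd (st (Suc n)))" for n
  have Inv: "Inv n (E n) (W n)" for n
    using st[THEN spec, of n] by (simp add: E_def W_def split: prod.splits)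
  have "\<exists>e. Step n (E n) (W n) (E (Suc n)) (W (Suc n)) e (v n)" for n
    using st[THEN spec, of n] by (simp add: E_def W_def v_def split: prod.splits)
  then obtain e where Step: "\<And>n. Step n (E n) (W n) (E (Suc n)) (W (Suc n)) (e n) (v n)" by metis
  have len: "length (v n False) = length (v n True)" and ne: "v n False \<noteq> v n True" for n
    using Step[of n] by (auto simp: Step_def)
  have "v n i \<noteq> []" for n i
    using len[of n] ne[of n] by (cases i) auto
  note ge = block_start_ge[of v _ "W 0 []", OF this]
  show ?thesis
  proof (rule that[OF len ne])
    fix x
    have ES: "E (Suc n) (map x [0..<Suc n]) = E n (map x [0..<n]) @ e n (x n)"
      "W (Suc n) (map x [0..<Suc n]) = W n (map x [0..<n]) @ v n (x n)"
      "\<exists>u\<in>S n. \<exists>v. E (Suc n) (map x [0..<Suc n]) = u @ v" for n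
      using Step[of n] by (auto simp: Step_def)
    \<comment> \<open>The argument strings along \<open>x\<close> converge to \<open>z\<close>,
      which passes through every \<open>S n\<close>; hence \<open>f z\<close> begins with every
      value string along \<open>x\<close>.\<close>
    obtain z where z: "\<And>n. \<exists>b. z = E n (map x [0..<n]) \<frown> b"
      using chain_limit[of "\<lambda>n. E n (map x [0..<n])"] ES(1) by metis
    have zS: "\<exists>u\<in>S n. \<exists>b. z = u \<frown> b" for n
      using z[of "Suc n"] ES(3)[of n] by (metis conc_conc)
    have fz: "\<exists>b. f z = W n (map x [0..<n]) \<frown> b" for n
    proof -
      obtain a where "z = E n (map x [0..<n]) \<frown> a" using z by blast
      moreover have "G (E n (map x [0..<n])) (W n (map x [0..<n]))"
        unfolding G_def using Inv[of n] unfolding Inv_def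
        by (rule generic_mono) auto
      ultimately show ?thesis using SG zS by blast
    qed
    have W: "W n (map x [0..<n]) = E0_string (W 0 []) v (map x [0..<n])" for n
    proof (induction n)
      case 0
      show ?case by (simp add: E0_string_def)
    next
      case (Suc n)
      then show ?case by (simp only: ES(2) E0_string_Suc)
    qed
    have "canonical_map (W 0 []) v x k = f z k" for k
    proof -
      have k: "k < length (E0_string (W 0 []) v (map x [0..<Suc k]))"
        using ge[of "Suc k"] unfolding length_E0_string_eq[OF len] by simp
      obtain b where "f z = E0_string (W 0 []) v (map x [0..<Suc k]) \<frown> b" using fz[of "Suc k"] W by metis
      with k canonical_map_eq[OF k] show ?thesis by simp
    qed
    then show "canonical_map (W 0 []) v x \<in> range f" by blast
  qed
qed

section \<open>The set \<open>D\<close>: avoided by a triple of branches, yet open and dense\<close>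

lemma triple_in_D_iff:
  "triple x y z \<in> D \<longleftrightarrow> (\<exists>n. x n \<noteq> y n \<and> x n \<noteq> z n \<and> y (n + 1) \<noteq> z (n + 1))"
proof -
  have nth: "triple x y z 0 = x" "triple x y z 1 = y" "triple x y z 2 = z" for x y z :: "nat \<Rightarrow> bool"
    by (simp_all add: triple_def)
  have "x = x' \<and> y = y' \<and> z = z'" if "triple x y z = triple x' y' z'" for x' y' z'
    using that nth by metis
  then show ?thesis unfolding D_def by blast
qed

text \<open>Stated for nonempty strings of equal length in each block, so that it covers both
  \<open>E0\<close>-trees and the tree obtained by fusion.\<close>

lemma canonical_triple_notin_D:
  assumes len: "\<And>n. length (v n False) = length (v n True)" and ne: "\<And>n i. v n i \<noteq> []"
  shows "triple (canonical_map s v (periodic [False, True, False]))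
      (canonical_map s v (periodic [True, True, False]))
      (canonical_map s v (periodic [True])) \<notin> D"
proof
  define x where "x = periodic [False, True, False]"
  define y where "y = periodic [True, True, False]"
  define z where "z = periodic [True]"
  let ?\<Phi> = "canonical_map s v"
  assume "triple (?\<Phi> (periodic [False, True, False])) (?\<Phi> (periodic [True, True, False]))
      (?\<Phi> (periodic [True])) \<in> D"
  then obtain k where k: "?\<Phi> x k \<noteq> ?\<Phi> y k" "?\<Phi> x k \<noteq> ?\<Phi> z k" "?\<Phi> y (k + 1) \<noteq> ?\<Phi> z (k + 1)"
    unfolding triple_in_D_iff x_def y_def z_def by blast
  note block = canonical_map_block[of v _ _ s, OF len]
  show False
  proof (cases rule: block_cases[of v k s, OF ne])
    case 1
    then show False using k(1) by (simp add: canonical_map_stem)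
  next
    case (2 n j)
    have xy: "x n \<noteq> y n"
    proof
      assume "x n = y n"
      then show False using k(1) 2 block[of j n] by simp
    qed
    \<comment> \<open>The first two branches choose alike at residues 1 and 2, so their difference
      at \<open>k\<close> puts \<open>k\<close> into a block of residue 0.\<close>
    have "n mod 3 = 0 \<or> n mod 3 = 1 \<or> n mod 3 = 2" by arith
    with xy have n: "n mod 3 = 0" by (auto simp: x_def y_def periodic_def)
    then have Sn: "Suc n mod 3 = 1" by arith
    have yz: "y n = z n" "y (Suc n) = z (Suc n)"
      using n Sn by (auto simp: y_def z_def periodic_def)
    \<comment> \<open>Position \<open>k + 1\<close> lies in the same block or is the first one of
      the next block, and on both blocks the second and third branches agree.\<close>
    show False
    proof (cases "Suc j < length (v n False)")
      case True
      then show False using k(3) yz(1) block[of "Suc j" n] 2(1) by simp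
    next
      case False
      then have "k + 1 = block_start s v (Suc n) + 0" using 2 by (simp add: block_start_def)
      then show False using k(3) yz(2) block[of 0 "Suc n"] ne[of "Suc n" False] by simp
    qed
  qed
qed

lemma D_eq: "D = {g \<in> topspace (power_space 3).
    \<exists>n. g 0 n \<noteq> g 1 n \<and> g 0 n \<noteq> g 2 n \<and> g 1 (n + 1) \<noteq> g 2 (n + 1)}"
proof -
  have "triple (g 0) (g 1) (g 2) = g" if "g \<in> topspace (power_space 3)" for g :: "nat \<Rightarrow> nat \<Rightarrow> bool"
  proof
    fix i :: nat
    have "i = 0 \<or> i = 1 \<or> i = 2 \<or> \<not> i < 3" by arith
    then show "triple (g 0) (g 1) (g 2) i = g i"
      using that by (auto simp: triple_def power_space_def PiE_def extensional_def)
  qed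
  then have "g \<in> D \<longleftrightarrow> (\<exists>n. g 0 n \<noteq> g 1 n \<and> g 0 n \<noteq> g 2 n \<and> g 1 (n + 1) \<noteq> g 2 (n + 1))"
    if "g \<in> topspace (power_space 3)" for g
    using triple_in_D_iff[of "g 0" "g 1" "g 2"] that by simp
  moreover have "D \<subseteq> topspace (power_space 3)"
    by (auto simp: D_def triple_def power_space_def)
  ultimately show ?thesis by blast
qed

lemma openin_D: "openin (power_space 3) D"
proof -
  let ?X = "power_space 3 :: (nat \<Rightarrow> nat \<Rightarrow> bool) topology"
  have coord: "openin ?X {g \<in> topspace ?X. g i n = b}" if "i < 3" for i n b
  proof -
    have "continuous_map ?X euclidean (\<lambda>g. g i)"
      unfolding power_space_def using that continuous_map_product_projection[of i "{..<3}" "\<lambda>_. euclidean"] by simp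
    moreover have "continuous_map euclidean euclidean (\<lambda>x::nat \<Rightarrow> bool. x n)"
      by (simp add: continuous_on_product_coordinates)
    ultimately have "continuous_map ?X euclidean (\<lambda>g. g i n)"
      using continuous_map_compose[of ?X euclidean "\<lambda>g. g i" euclidean "\<lambda>x. x n"] by (simp add: o_def)
    from openin_continuous_map_preimage[OF this, of "{b}"] show ?thesis
      by (simp add: open_discrete)
  qed
  \<comment> \<open>Fixing the letters \<open>b\<close> and \<open>c\<close> turns the inequalities
    into conditions on single coordinates, so \<open>D\<close> is a union of finite intersections of
    subbasic open sets.\<close>
  have "D = (\<Union>n. \<Union>b. \<Union>c. {g \<in> topspace ?X. g 0 n = b} \<inter> {g \<in> topspace ?X. g 1 n = (\<not> b)} \<inter>
      {g \<in> topspace ?X. g 2 n = (\<not> b)} \<inter> {g \<in> topspace ?X. g 1 (n + 1) = c} \<inter>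
      {g \<in> topspace ?X. g 2 (n + 1) = (\<not> c)})"
    unfolding D_eq by auto
  moreover have "openin ?X \<dots>"
    by (intro openin_Union openin_Int coord ballI | clarsimp)+
  ultimately show ?thesis by simp
qed

lemma dense_D: "power_space 3 closure_of D = topspace (power_space 3)"
  unfolding dense_intersects_open
proof (intro allI impI, elim conjE)
  fix U :: "(nat \<Rightarrow> nat \<Rightarrow> bool) set"
  assume U: "openin (power_space 3) U" "U \<noteq> {}"
  then obtain x where "x \<in> U" by blast
  with U(1) obtain X where X: "x \<in> Pi\<^sub>E {..<3} X" "\<And>i. open (X i)" "Pi\<^sub>E {..<3} X \<subseteq> U"
    unfolding power_space_def using product_topology_open_contains_basis[of "\<lambda>_. euclidean" "{..<3}" U x]
    by auto
  have "\<forall>i<3. \<exists>k. \<forall>y. (\<forall>j<k. y j = x i j) \<longrightarrow> y \<in> X i"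
  proof (intro allI impI)
    fix i :: nat assume "i < 3"
    with X(1) have "x i \<in> X i" by auto
    from open_cylinder[OF X(2) this] show "\<exists>k. \<forall>y. (\<forall>j<k. y j = x i j) \<longrightarrow> y \<in> X i" by metis
  qed
  then obtain k where k: "\<And>i y. i < 3 \<Longrightarrow> (\<And>j. j < k i \<Longrightarrow> y j = x i j) \<Longrightarrow> y \<in> X i" by metis
  \<comment> \<open>A common bound: the box around \<open>x\<close> leaves all letters from
    \<open>N\<close> on free.\<close>
  define N where "N = (\<Sum>i<3. k i)"
  have N: "k i \<le> N" if "i < 3" for i
    unfolding N_def using that by (intro member_le_sum) auto
  \<comment> \<open>From \<open>N\<close> on, the first sequence is constantly 1 and the second
    constantly 0; the third is 0 at \<open>N\<close> and 1 afterwards. So \<open>N\<close> witnesses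
    membership in \<open>D\<close>.\<close>
  define g where "g = (\<lambda>i\<in>{..<3::nat}. \<lambda>m. if m < N then x i m else i = 0 \<or> (i = 2 \<and> m \<noteq> N))"
  have "g \<in> Pi\<^sub>E {..<3} X"
    unfolding g_def by (rule restrict_PiE_iff[THEN iffD2]) (auto intro!: k dest: N)
  moreover have "g \<in> D"
    unfolding D_eq by (auto simp: g_def power_space_def intro!: exI[of _ N])
  ultimately show "D \<inter> U \<noteq> {}" using X(3) by blast
qed

section \<open>Failure of the Mycielski property\<close>

text \<open>The complement is closed with empty interior, so it is itself nowhere dense.\<close>

lemma comeager_in_open_dense:
  assumes "openin X U" "X closure_of U = topspace X"
  shows "comeager_in X U"
proof -
  have "X closure_of (topspace X - U) = topspace X - U"
    by (intro closure_of_closedin closedin_diff closedin_topspace assms(1))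
  then have "nowhere_dense_in X (topspace X - U)"
    using assms(2) by (simp add: nowhere_dense_in_def interior_of_complement)
  then have "meager_in X (topspace X - U)"
    unfolding meager_in_def by (intro exI[of _ "{topspace X - U}"]) simp
  with assms(1) show ?thesis by (simp add: comeager_in_def openin_subset)
qed

lemma not_mycielski_property_3_E0: "\<not> mycielski_property 3 E0"
proof
  assume "mycielski_property 3 E0"
  then obtain A where A: "borel_reducible UNIV E0 A (Restr E0 A)" "inequivalent_tuples 3 E0 A \<subseteq> D"
    using comeager_in_open_dense[OF openin_D dense_D]
    unfolding mycielski_property_def borel_bireducible_def by blast
  have "measurable (restrict_space borel UNIV) (restrict_space borel A) =
      measurable borel (restrict_space borel A)"
    by (rule measurable_cong_sets) (simp_all add: sets_restrict_space)
  with A(1) obtain f where f: "f \<in> measurable borel (restrict_space borel A)"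
    and red: "\<forall>a\<in>UNIV. \<forall>b\<in>UNIV. (a, b) \<in> E0 \<longleftrightarrow> (f a, f b) \<in> Restr E0 A"
    unfolding borel_reducible_def by blast
  have fA: "f a \<in> A" for a
    using measurable_space[OF f, of a] by (simp add: space_restrict_space)
  have "E0_reduction f"
    unfolding E0_reduction_def using f red fA by (auto simp: measurable_restrict_space2_iff)
  then obtain s v where len: "\<And>n. length (v n False) = length (v n True)"
    and ne: "\<And>n. v n False \<noteq> v n True" and vf: "\<And>x. canonical_map s v x \<in> range f"
    by (rule E0_reduction_tree) blast
  have ne': "v n i \<noteq> []" for n i using len[of n] ne[of n] by (cases i) auto
  define x where "x = periodic [False, True, False]"
  define y where "y = periodic [True, True, False]"
  define z where "z = periodic [True]"
  let ?\<Phi> = "canonical_map s v"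
  \<comment> \<open>Residue 0 separates \<open>x\<close> from \<open>y\<close> and \<open>z\<close>,
    residue 2 separates \<open>y\<close> from \<open>z\<close>; the factor \<open>Suc N\<close>
    takes the positions beyond \<open>N\<close>.\<close>
  have "x (3 * Suc N) \<noteq> y (3 * Suc N)" "x (3 * Suc N) \<noteq> z (3 * Suc N)"
    "y (3 * Suc N + 2) \<noteq> z (3 * Suc N + 2)" "3 * Suc N > N" "3 * Suc N + 2 > N" for N
    by (simp_all add: x_def y_def z_def periodic_def mod_Suc)
  then have "\<exists>n>N. x n \<noteq> y n" "\<exists>n>N. x n \<noteq> z n" "\<exists>n>N. y n \<noteq> z n" for N by blast+
  then have ineq: "(?\<Phi> x, ?\<Phi> y) \<notin> E0" "(?\<Phi> x, ?\<Phi> z) \<notin> E0" "(?\<Phi> y, ?\<Phi> z) \<notin> E0"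
    by (intro canonical_map_not_E0 len ne ne'; blast)+
  have sym: "(a, b) \<in> E0 \<Longrightarrow> (b, a) \<in> E0" for a b
    using equiv_E0 by (meson equivE symE)
  have \<Phi>A: "?\<Phi> u \<in> A" for u using vf[of u] fA by auto
  have less3: "i < 3 \<longleftrightarrow> i = 0 \<or> i = 1 \<or> i = 2" for i :: nat by auto
  have "triple (?\<Phi> x) (?\<Phi> y) (?\<Phi> z) \<in> inequivalent_tuples 3 E0 A"
    unfolding inequivalent_tuples_def triple_def using \<Phi>A ineq sym by (auto simp: less3 PiE_def)
  with A(2) canonical_triple_notin_D[of v s] len ne' show False
    unfolding x_def y_def z_def by blast
qed

theorem theorem8p1:
  shows "openin (power_space 3) D \<and>
    power_space 3 closure_of D = topspace (power_space 3) \<and>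
    (\<forall>p s v. E0_tree_with p s v \<longrightarrow>
       triple (canonical_map s v (periodic [False, True, False]))
              (canonical_map s v (periodic [True, True, False]))
              (canonical_map s v (periodic [True])) \<notin> D) \<and>
    \<not> mycielski_property 3 E0"
proof (intro conjI allI impI openin_D dense_D not_mycielski_property_3_E0)
  fix p s v assume "E0_tree_with p s v"
  then have len: "length (v n False) = length (v n True)" and pre: "Sublist.prefix [i] (v n i)" for n i
    by (simp_all add: E0_tree_with_def)
  have "v n i \<noteq> []" for n i
    using pre[of i n] by (cases "v n i") simp_all
  with len show "triple (canonical_map s v (periodic [False, True, False]))
              (canonical_map s v (periodic [True, True, False]))
              (canonical_map s v (periodic [True])) \<notin> D"
    by (rule canonical_triple_notin_D)
qed

end
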